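(* Let $\mathbb{F}$ be a division ring and assume that for all $a \in \mathbb{F}$ there is $k \in \mathbb{N}$ such that $a - k \notin \mathbb{F}^{**}$. Then the multiplication of $\mathbb{F}$ is commutative and $\mathbb{F}$ is a formally real field.
   Context: $\mathbb{N} = \{1,2,3,\dots\}$. Division rings are associative and unital; $k\in\mathbb{N}$ is regarded as the element $k\cdot 1$ of $\mathbb{F}$. $\mathbb{F}^{**}$ denotes the set of all finite sums (including the empty sum $0$) of products of squares in $\mathbb{F}$, i.e. the submonoid of the additive group of $\mathbb{F}$ generated by $\{(a_1)^2 \cdots (a_n)^2 \mid n \in \mathbb{N},\ a_1,\dots,a_n \in \mathbb{F}\}$. A division ring $\mathbb{F}$ is called formally real if $-1 \notin \mathbb{F}^{**}$ (for a field: $-1$ is not a sum of squares). *)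

theory Defs
  imports Main
begin

definition products_of_squares :: "'a::division_ring set" where
  "products_of_squares = {prod_list (map (\<lambda>a. a\<^sup>2) as) | as. as \<noteq> []}"

text \<open>The set written F** in the mathematical text; the empty list gives the empty sum 0.\<close>

definition sums_of_products_of_squares :: "'a::division_ring set" where
  "sums_of_products_of_squares = {sum_list ps | ps. set ps \<subseteq> products_of_squares}"

definition formally_real :: "'a::division_ring itself \<Rightarrow> bool" where
  "formally_real TYPE('a) \<longleftrightarrow> - 1 \<notin> (sums_of_products_of_squares :: 'a set)"

text \<open>Over a field this is the usual notion: -1 is not a sum of squares.\<close>

lemma formally_real_field_iff:
  "formally_real TYPE('a::field) \<longleftrightarrow> (\<nexists>as :: 'a list. - 1 = (\<Sum>a\<leftarrow>as. a\<^sup>2))"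
proof -
  have prod: "prod_list (map (\<lambda>a. a\<^sup>2) as) = (prod_list as)\<^sup>2" for as :: "'a list"
    by (induction as) (auto simp: power_mult_distrib)
  have "a\<^sup>2 \<in> products_of_squares" for a :: 'a
    unfolding products_of_squares_def by (rule CollectI, rule exI[of _ "[a]"]) simp
  then have sq: "products_of_squares = range (\<lambda>a :: 'a. a\<^sup>2)"
    by (auto simp: products_of_squares_def prod)
  have "set ps \<subseteq> range (\<lambda>a :: 'a. a\<^sup>2) \<longleftrightarrow> (\<exists>as. ps = map (\<lambda>a. a\<^sup>2) as)" for ps
    unfolding subset_iff image_iff by (subst ex_map_conv) auto
  then show ?thesis
    unfolding formally_real_def sums_of_products_of_squares_def sq by simp blast
qed

end

theory Submission
  imports Defs
begin

text \<open>
  Write \<open>P\<close> for the set of sums of products of squares and think of \<open>a \<le> b\<close> as \<open>b - a \<in> P\<close>.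
  The hypothesis says that no element lies above all natural numbers. Applied to \<open>0\<close> it gives
  \<open>- 1 \<notin> P\<close> at once, so \<open>P\<close> is a preordering and \<open>P - {0}\<close> is a normal subgroup of the
  multiplicative group.

  For commutativity, let \<open>a\<close> and \<open>b\<close> be bounded by natural numbers, and first let the order be
  total. Then \<open>m * a\<close> and \<open>m * b\<close> differ from integers by some \<open>\<alpha>\<close>, \<open>\<beta>\<close> between \<open>0\<close> and \<open>1\<close>,
  and as integers are central, \<open>m\<^sup>2 * (a * b - b * a) = \<alpha> * \<beta> - \<beta> * \<alpha>\<close> lies between \<open>- 1\<close> and
  \<open>1\<close>, for every \<open>m\<close> (\<open>commutator_bounded\<close>). This classical argument shows that the commutator
  \<open>c\<close> of \<open>a\<close> and \<open>b\<close> is infinitesimal. A preordering is the intersection of the total orderings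
  that contain it (\<open>mem_if_mem_total_extensions\<close>), so \<open>c\<close> is infinitesimal for \<open>P\<close> as well. If
  \<open>c\<close> were not \<open>0\<close>, then \<open>inverse (c\<^sup>2)\<close> would lie above all natural numbers, which is excluded.
  Hence bounded elements commute (\<open>bounded_commute\<close>).

  The total orderings themselves may fail to be Archimedean, and not every element is bounded:
  the field of rational functions over the reals satisfies the hypothesis. But every element is a
  quotient of two bounded ones, since \<open>2 * a = (2 * a / (1 + a\<^sup>2)) / (1 / (1 + a\<^sup>2))\<close>. So all
  elements commute.
\<close>

section \<open>Preorderings of a division ring\<close>

locale ring_preordering =
  fixes P :: "'a::division_ring set"
  assumes square_mem: "x\<^sup>2 \<in> P"
    and add_mem: "x \<in> P \<Longrightarrow> y \<in> P \<Longrightarrow> x + y \<in> P"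
    and mult_mem: "x \<in> P \<Longrightarrow> y \<in> P \<Longrightarrow> x * y \<in> P"
    and minus_one_not_mem: "- 1 \<notin> P"
begin

lemma zero_mem: "0 \<in> P"
  using square_mem[of 0] by simp

lemma one_mem: "1 \<in> P"
  using square_mem[of 1] by simp

lemma of_nat_mem: "of_nat n \<in> P"
  by (induction n) (auto intro: zero_mem one_mem add_mem)

lemma inverse_mem:
  assumes "x \<in> P"
  shows "inverse x \<in> P"
proof (cases "x = 0")
  case False
  then have "inverse x = x * (inverse x)\<^sup>2"
    by (simp add: power2_eq_square mult.assoc[symmetric])
  then show ?thesis
    using mult_mem[OF assms square_mem] by metis
qed (simp add: zero_mem)

lemma antisym:
  assumes "x \<in> P" "- x \<in> P"
  shows "x = 0"
proof (rule ccontr)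
  assume "x \<noteq> 0"
  then have "- x * inverse x = - 1"
    by simp
  then show False
    using mult_mem[OF assms(2) inverse_mem[OF assms(1)]] minus_one_not_mem by simp
qed

lemma of_nat_Suc_neq_0: "of_nat (Suc n) \<noteq> (0::'a)"
proof
  assume "of_nat (Suc n) = (0::'a)"
  then have "of_nat n = (- 1 :: 'a)"
    by (simp add: eq_neg_iff_add_eq_0 add.commute)
  then show False
    using of_nat_mem[of n] minus_one_not_mem by simp
qed

text \<open>
  Conjugating a square gives a square, but a general preordering has further elements. They are
  conjugated within \<open>P\<close> because commutators are products of squares.
\<close>

lemma conjugate_mem:
  assumes "p \<in> P" "a \<noteq> 0"
  shows "inverse a * p * a \<in> P"
proof (cases "p = 0")
  case False
  have "p * (inverse p * (a * a)) = a * a"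
    using False by (simp add: mult.assoc[symmetric])
  then have "(inverse a * p)\<^sup>2 * inverse p * a\<^sup>2 = inverse a * p * (inverse a * a) * a"
    by (simp add: power2_eq_square mult.assoc)
  then have "(inverse a * p)\<^sup>2 * inverse p * a\<^sup>2 = inverse a * p * a"
    using assms(2) by simp
  then show ?thesis
    using mult_mem[OF mult_mem[OF square_mem inverse_mem[OF assms(1)]] square_mem] by metis
qed (simp add: zero_mem)

section \<open>Extension to total orderings\<close>

text \<open>
  Sums and products of elements of \<open>P\<close> and \<open>x\<close> can be brought into the form \<open>p + x * q\<close>, since
  \<open>P\<close> is invariant under conjugation by \<open>x\<close> and contains \<open>x\<^sup>2\<close>. If \<open>- 1\<close> had this form, then
  \<open>- x = (1 + p) * inverse q\<close> would lie in \<open>P\<close>.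
\<close>

lemma preordering_adjoin:
  assumes "- x \<notin> P"
  shows "ring_preordering {p + x * q | p q. p \<in> P \<and> q \<in> P}" (is "ring_preordering ?Q")
proof
  have x: "x \<noteq> 0"
    using assms zero_mem by auto
  fix y z :: 'a
  show "y\<^sup>2 \<in> ?Q"
    using square_mem[of y] zero_mem by force
  show "y + z \<in> ?Q" if "y \<in> ?Q" "z \<in> ?Q"
  proof -
    from that obtain p q r s where "y = p + x * q" "z = r + x * s"
      and mem: "p \<in> P" "q \<in> P" "r \<in> P" "s \<in> P"
      by auto
    then have "y + z = (p + r) + x * (q + s)"
      by (simp add: algebra_simps)
    then show ?thesis
      using mem add_mem by blast
  qed
  show "y * z \<in> ?Q" if "y \<in> ?Q" "z \<in> ?Q"
  proof -
    from that obtain p q r s where yz: "y = p + x * q" "z = r + x * s"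
      and mem: "p \<in> P" "q \<in> P" "r \<in> P" "s \<in> P"
      by auto
    \<comment> \<open>Normality of \<open>P\<close> lets \<open>x\<close> pass to the left of an element of \<open>P\<close>.\<close>
    define conj where "conj t = inverse x * t * x" for t
    have move: "t * x = x * conj t" for t
      using x by (simp add: conj_def mult.assoc[symmetric])
    have conj: "conj t \<in> P" if "t \<in> P" for t
      unfolding conj_def by (rule conjugate_mem[OF that x])
    have "p * (x * s) = x * conj p * s" "x * q * (x * s) = x\<^sup>2 * conj q * s"
      using move[of p] move[of q] by (simp_all add: power2_eq_square mult.assoc[symmetric])
         (simp add: mult.assoc)
    then have "y * z = (p * r + x\<^sup>2 * conj q * s) + x * (conj p * s + q * r)"
      unfolding yz by (simp add: algebra_simps)
    moreover have "p * r + x\<^sup>2 * conj q * s \<in> P" "conj p * s + q * r \<in> P"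
      by (intro add_mem mult_mem square_mem conj mem)+
    ultimately show ?thesis
      by blast
  qed
  show "- 1 \<notin> ?Q"
  proof
    assume "- 1 \<in> ?Q"
    then obtain p q where eq: "- 1 = p + x * q" and mem: "p \<in> P" "q \<in> P"
      by auto
    have *: "- x * q = 1 + p"
      using eq[symmetric] by (simp add: eq_neg_iff_add_eq_0 neg_eq_iff_add_eq_0 ac_simps)
    have "q \<noteq> 0"
    proof
      assume "q = 0"
      then show False
        using eq mem minus_one_not_mem by simp
    qed
    then have "- x = (1 + p) * inverse q"
      unfolding *[symmetric] by (simp add: mult.assoc)
    then show False
      using assms mult_mem[OF add_mem[OF one_mem mem(1)] inverse_mem[OF mem(2)]] by simp
  qed
qed

lemma subset_adjoin: "P \<subseteq> {p + x * q | p q. p \<in> P \<and> q \<in> P}"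
  using zero_mem by force

lemma mem_adjoin: "x \<in> {p + x * q | p q. p \<in> P \<and> q \<in> P}"
  using zero_mem one_mem by force

end

lemma preordering_Union_chain:
  assumes "subset.chain {Q. ring_preordering Q} C" "C \<noteq> {}"
  shows "ring_preordering (\<Union>C)"
proof
  have pre: "ring_preordering Q" if "Q \<in> C" for Q
    using assms(1) that by (auto simp: subset.chain_def)
  have upper: "\<exists>Q\<in>C. x \<in> Q \<and> y \<in> Q" if "x \<in> \<Union>C" "y \<in> \<Union>C" for x y
    using that assms(1) unfolding subset_chain_def by blast
  fix x y :: 'a
  show "x\<^sup>2 \<in> \<Union>C"
    using assms(2) pre ring_preordering.square_mem by blast
  show "x + y \<in> \<Union>C" "x * y \<in> \<Union>C" if "x \<in> \<Union>C" "y \<in> \<Union>C"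
    using upper[OF that] pre ring_preordering.add_mem ring_preordering.mult_mem by blast+
  show "- 1 \<notin> \<Union>C"
    using pre ring_preordering.minus_one_not_mem by blast
qed

locale total_ring_ordering = ring_preordering +
  assumes total: "x \<in> P \<or> - x \<in> P"

text \<open>
  A preordering that is maximal by Zorn's lemma is total, because an element \<open>x\<close> can be adjoined
  unless \<open>- x\<close> is present.
\<close>

lemma (in ring_preordering) ex_total_extension: "\<exists>Q. P \<subseteq> Q \<and> total_ring_ordering Q"
proof -
  let ?A = "{Q. ring_preordering Q \<and> P \<subseteq> Q}"
  have "\<exists>M\<in>?A. \<forall>X\<in>?A. M \<subseteq> X \<longrightarrow> X = M"
  proof (rule subset_Zorn_nonempty)
    show "?A \<noteq> {}"
      using ring_preordering_axioms by blast
    fix C assume C: "C \<noteq> {}" "subset.chain ?A C"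
    then have "subset.chain {Q. ring_preordering Q} C"
      by (auto simp: subset.chain_def)
    then have "ring_preordering (\<Union>C)"
      using C(1) by (rule preordering_Union_chain)
    moreover obtain Q where "Q \<in> C"
      using C(1) by blast
    then have "P \<subseteq> \<Union>C"
      using C(2) by (auto simp: subset.chain_def)
    ultimately show "\<Union>C \<in> ?A"
      by simp
  qed
  then obtain M where "M \<in> ?A" and "\<forall>X\<in>?A. M \<subseteq> X \<longrightarrow> X = M" ..
  then have M: "ring_preordering M" "P \<subseteq> M"
    and max: "\<And>X. ring_preordering X \<Longrightarrow> P \<subseteq> X \<Longrightarrow> M \<subseteq> X \<Longrightarrow> X = M"
    by simp_all
  interpret M: ring_preordering M
    by (rule M(1))
  have "x \<in> M \<or> - x \<in> M" for x
  proof (cases "- x \<in> M")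
    case False
    show ?thesis
      using max[OF M.preordering_adjoin[OF False] subset_trans[OF M(2) M.subset_adjoin]
          M.subset_adjoin] M.mem_adjoin[of x]
      by simp
  qed simp
  then have "total_ring_ordering M"
    by unfold_locales
  then show ?thesis
    using M(2) by blast
qed

text \<open>If \<open>x \<notin> P\<close>, then \<open>- x\<close> can be adjoined, and a total extension of the result omits \<open>x\<close>.\<close>

lemma (in ring_preordering) mem_if_mem_total_extensions:
  assumes "\<And>Q. total_ring_ordering Q \<Longrightarrow> P \<subseteq> Q \<Longrightarrow> x \<in> Q"
  shows "x \<in> P"
proof (rule ccontr)
  assume "x \<notin> P"
  then have *: "- (- x) \<notin> P"
    by simp
  interpret Q: ring_preordering "{p + - x * q | p q. p \<in> P \<and> q \<in> P}"
    by (rule preordering_adjoin[OF *])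
  obtain R where R: "{p + - x * q | p q. p \<in> P \<and> q \<in> P} \<subseteq> R" "total_ring_ordering R"
    using Q.ex_total_extension by blast
  interpret R: total_ring_ordering R
    by (rule R(2))
  have "x \<in> R" "- x \<in> R"
    using assms[OF R(2)] R(1) subset_adjoin[of "- x"] mem_adjoin[of "- x"] by blast+
  then have "x = 0"
    by (rule R.antisym)
  then show False
    using \<open>x \<notin> P\<close> zero_mem by simp
qed

section \<open>Commutators of bounded elements\<close>

lemma (in total_ring_ordering) ex_floor_nonneg:
  "z \<in> P \<Longrightarrow> of_nat n - z \<in> P \<Longrightarrow> \<exists>i::nat. z - of_nat i \<in> P \<and> of_nat i + 1 - z \<in> P"
proof (induction n)
  case 0
  then show ?case
    using add_mem[OF 0(2) one_mem] by (intro exI[of _ 0]) simp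
next
  case (Suc n)
  show ?case
  proof (cases "of_nat n - z \<in> P")
    case False
    then have "z - of_nat n \<in> P"
      using total[of "of_nat n - z"] by simp
    then show ?thesis
      using Suc.prems(2) by (intro exI[of _ n]) (simp add: add.commute)
  qed (use Suc in blast)
qed

definition bounded_by :: "'a::division_ring set \<Rightarrow> nat \<Rightarrow> 'a \<Rightarrow> bool" where
  "bounded_by P n a \<longleftrightarrow> of_nat n - a \<in> P \<and> of_nat n + a \<in> P"

lemma (in ring_preordering) bounded_by_of_nat_mult:
  assumes "bounded_by P n a"
  shows "bounded_by P (m * n) (of_nat m * a)"
  using assms mult_mem[OF of_nat_mem[of m], of "of_nat n - a"]
    mult_mem[OF of_nat_mem[of m], of "of_nat n + a"]
  by (simp add: bounded_by_def algebra_simps)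

text \<open>
  Here \<open>t\<close> is an integer part of \<open>a\<close>. Only its centrality is recorded: it ensures that passing
  from \<open>a\<close> to the fractional part \<open>a - t\<close> does not change commutators.
\<close>

lemma (in total_ring_ordering) ex_central_translate:
  assumes "bounded_by P n a"
  shows "\<exists>t. (\<forall>x. t * x = x * t) \<and> a - t \<in> P \<and> 1 - (a - t) \<in> P"
proof -
  have "a + of_nat n \<in> P" "of_nat (2 * n) - (a + of_nat n) \<in> P"
    using assms by (simp_all add: bounded_by_def add.commute mult_2)
  then obtain i :: nat
    where "a + of_nat n - of_nat i \<in> P" "of_nat i + 1 - (a + of_nat n) \<in> P"
    using ex_floor_nonneg by blast
  then show ?thesis
    by (intro exI[of _ "of_nat i - of_nat n"])
      (simp add: algebra_simps mult_of_nat_commute)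
qed

text \<open>The products of two elements between \<open>0\<close> and \<open>1\<close> again lie between \<open>0\<close> and \<open>1\<close>.\<close>

lemma (in ring_preordering) one_minus_commutator_mem:
  assumes "x \<in> P" "1 - x \<in> P" "y \<in> P" "1 - y \<in> P"
  shows "1 - (x * y - y * x) \<in> P"
proof -
  have "1 - (x * y - y * x) = (1 - x) + x * (1 - y) + y * x"
    by (simp add: algebra_simps)
  also have "\<dots> \<in> P"
    by (intro add_mem mult_mem assms)
  finally show ?thesis .
qed

lemma (in total_ring_ordering) commutator_bounded:
  assumes "bounded_by P n a" "bounded_by P k b"
  shows "bounded_by P 1 (a * b - b * a)"
proof -
  obtain s where s: "\<And>x. s * x = x * s" "a - s \<in> P" "1 - (a - s) \<in> P"
    using ex_central_translate[OF assms(1)] by blast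
  obtain t where t: "\<And>x. t * x = x * t" "b - t \<in> P" "1 - (b - t) \<in> P"
    using ex_central_translate[OF assms(2)] by blast
  have *: "(a - s) * (b - t) - (b - t) * (a - s) = a * b - b * a"
    using s(1)[of b] s(1)[of t] t(1)[of a] by (simp add: algebra_simps)
  have "1 - (a * b - b * a) \<in> P"
    using one_minus_commutator_mem[OF s(2,3) t(2,3)] by (simp only: *)
  moreover have "1 - (b * a - a * b) \<in> P"
    using one_minus_commutator_mem[OF t(2,3) s(2,3)] * by (simp add: algebra_simps)
  ultimately show ?thesis
    by (simp add: bounded_by_def algebra_simps)
qed

lemma of_nat_mult_of_nat_mult:
  fixes x y :: "'a::semiring_1"
  shows "of_nat m * x * (of_nat m * y) = of_nat (m * m) * (x * y)"
proof -
  have "of_nat m * x * (of_nat m * y) = of_nat m * (x * of_nat m) * y"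
    by (simp only: mult.assoc)
  also have "\<dots> = of_nat m * (of_nat m * x) * y"
    by (simp only: mult_of_nat_commute)
  finally show ?thesis
    by (simp add: mult.assoc)
qed

text \<open>
  The bound from the total orderings, applied to \<open>of_nat m * a\<close> and \<open>of_nat m * b\<close>, holds for every
  \<open>m\<close>. It is stated for the square of the commutator \<open>c\<close> because \<open>c\<close> need not be comparable
  with \<open>0\<close> in \<open>P\<close>, whereas \<open>c\<^sup>2\<close> lies in \<open>P\<close> and can be cancelled from the inequality.
\<close>

lemma (in ring_preordering) commutator_infinitesimal:
  assumes "bounded_by P n a" "bounded_by P k b"
  shows "1 - (of_nat (m * m) * (a * b - b * a))\<^sup>2 \<in> P"
proof (rule mem_if_mem_total_extensions)
  fix Q assume Q: "total_ring_ordering Q" "P \<subseteq> Q"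
  interpret Q: total_ring_ordering Q
    by (rule Q(1))
  let ?c = "of_nat (m * m) * (a * b - b * a)"
  have bounds: "bounded_by Q n a" "bounded_by Q k b"
    using assms Q(2) by (auto simp: bounded_by_def)
  have "bounded_by Q 1 (of_nat m * a * (of_nat m * b) - of_nat m * b * (of_nat m * a))"
    by (rule Q.commutator_bounded[OF bounds[THEN Q.bounded_by_of_nat_mult]])
  also have "of_nat m * a * (of_nat m * b) - of_nat m * b * (of_nat m * a) = ?c"
    by (simp only: of_nat_mult_of_nat_mult right_diff_distrib)
  finally have "1 - ?c \<in> Q" "1 + ?c \<in> Q"
    by (simp_all add: bounded_by_def)
  then have "(1 - ?c) * (1 + ?c) \<in> Q"
    by (rule Q.mult_mem)
  also have "(1 - ?c) * (1 + ?c) = 1 - ?c\<^sup>2"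
    by (simp add: algebra_simps power2_eq_square del: of_nat_mult)
  finally show "1 - ?c\<^sup>2 \<in> Q" .
qed

section \<open>Preorderings without infinitely large elements\<close>

locale weakly_archimedean_ring_preordering = ring_preordering +
  assumes weakly_archimedean: "\<exists>k::nat. a - of_nat k \<notin> P"
begin

lemma bounded_commute:
  assumes "bounded_by P n a" "bounded_by P k b"
  shows "a * b = b * a"
proof (rule ccontr)
  assume "a * b \<noteq> b * a"
  define c where "c = a * b - b * a"
  have c: "c \<noteq> 0"
    using \<open>a * b \<noteq> b * a\<close> by (simp add: c_def)
  have "(inverse c)\<^sup>2 - of_nat m \<in> P" for m
  proof -
    define N where "N = (m * m) * (m * m)"
    have N: "(of_nat (m * m) * c)\<^sup>2 = of_nat N * c\<^sup>2"
      unfolding N_def power2_eq_square by (rule of_nat_mult_of_nat_mult)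
    have cancel: "c\<^sup>2 * (inverse c)\<^sup>2 = 1"
      using c by (simp add: power_inverse)
    have "(1 - (of_nat (m * m) * c)\<^sup>2) * (inverse c)\<^sup>2 \<in> P"
      using commutator_infinitesimal[OF assms, of m] unfolding c_def
      by (rule mult_mem[OF _ square_mem])
    also have "(1 - (of_nat (m * m) * c)\<^sup>2) * (inverse c)\<^sup>2 = (inverse c)\<^sup>2 - of_nat N"
      unfolding N by (simp add: left_diff_distrib mult.assoc cancel)
    finally have "(inverse c)\<^sup>2 - of_nat N + of_nat (N - m) \<in> P"
      by (rule add_mem[OF _ of_nat_mem])
    moreover have "m \<le> N"
      unfolding N_def by (meson le_square le_trans)
    ultimately show ?thesis
      by (simp add: of_nat_diff)
  qed
  then show False
    using weakly_archimedean by blast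
qed

text \<open>
  The elements \<open>u x\<close> and \<open>w x\<close> below are bounded by \<open>1\<close> because \<open>1 - u x = x\<^sup>2 * u x\<close> and
  \<open>1 \<plusminus> w x = (1 \<plusminus> x)\<^sup>2 * u x\<close>, and \<open>2 * x\<close> is their quotient. The factor \<open>2\<close> completes the squares.
\<close>

lemma commute:
  fixes a b :: 'a
  shows "a * b = b * a"
proof -
  define u where "u x = inverse (1 + x\<^sup>2)" for x :: 'a
  define w where "w x = of_nat 2 * x * u x" for x :: 'a
  have nz: "1 + x\<^sup>2 \<noteq> 0" for x :: 'a
  proof
    assume "1 + x\<^sup>2 = 0"
    then have "x\<^sup>2 = - 1"
      by (simp add: eq_neg_iff_add_eq_0 add.commute)
    then show False
      using square_mem[of x] minus_one_not_mem by simp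
  qed
  have u_mem: "u x \<in> P" for x
    unfolding u_def by (intro inverse_mem add_mem one_mem square_mem)
  have one_eq: "1 = (1 + x\<^sup>2) * u x" for x
    using nz by (simp add: u_def)
  have "bounded_by P 1 (u x)" for x
  proof -
    have "1 - u x = x\<^sup>2 * u x"
      using one_eq[of x] by (simp add: algebra_simps)
    then show ?thesis
      using mult_mem[OF square_mem u_mem] add_mem[OF one_mem u_mem]
      by (simp add: bounded_by_def)
  qed
  moreover have "bounded_by P 1 (w x)" for x
  proof -
    have "1 + w x = (1 + x)\<^sup>2 * u x" "1 - w x = (1 - x)\<^sup>2 * u x"
      using one_eq[of x] by (simp_all add: w_def algebra_simps power2_eq_square mult_2)
    then show ?thesis
      using mult_mem[OF square_mem u_mem] by (simp add: bounded_by_def)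
  qed
  ultimately have uu: "u a * u b = u b * u a" and uw: "u a * w b = w b * u a"
    and wu: "w a * u b = u b * w a" and ww: "w a * w b = w b * w a"
    by (blast intro: bounded_commute)+
  have quot: "of_nat 2 * x = w x * inverse (u x)" for x
    using nz by (simp add: w_def u_def mult.assoc)
  define u' where "u' x = inverse (u x)" for x
  have u'_w: "u' a * w b = w b * u' a" "u' b * w a = w a * u' b"
    unfolding u'_def by (intro mult_commute_imp_mult_inverse_commute uw wu[symmetric])+
  have u'_u': "u' a * u' b = u' b * u' a"
    unfolding u'_def
    by (intro mult_commute_imp_mult_inverse_commute)
      (rule mult_commute_imp_mult_inverse_commute[OF uu[symmetric], symmetric])
  have "(w a * u' a) * (w b * u' b) = (w a * w b) * (u' a * u' b)"
    using u'_w(1) by (metis mult.assoc)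
  also have "\<dots> = (w b * w a) * (u' b * u' a)"
    by (simp only: ww u'_u')
  also have "\<dots> = (w b * u' b) * (w a * u' a)"
    using u'_w(2) by (metis mult.assoc)
  finally have "of_nat 2 * a * (of_nat 2 * b) = of_nat 2 * b * (of_nat 2 * a)"
    by (simp only: quot u'_def)
  then have "of_nat (2 * 2) * (a * b) = of_nat (2 * 2) * (b * a)"
    by (simp only: of_nat_mult_of_nat_mult)
  then show ?thesis
    using of_nat_Suc_neq_0[of 3] by simp
qed

end

section \<open>Sums of products of squares\<close>

lemma square_mem_sums: "x\<^sup>2 \<in> sums_of_products_of_squares"
proof -
  have "x\<^sup>2 \<in> products_of_squares"
    unfolding products_of_squares_def by (rule CollectI, rule exI[of _ "[x]"]) simp
  then show ?thesis
    unfolding sums_of_products_of_squares_def by (intro CollectI exI[of _ "[x\<^sup>2]"]) simp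
qed

lemma add_mem_sums:
  assumes "x \<in> sums_of_products_of_squares" "y \<in> sums_of_products_of_squares"
  shows "x + y \<in> sums_of_products_of_squares"
proof -
  obtain ps qs where "x = sum_list ps" "set ps \<subseteq> products_of_squares"
    "y = sum_list qs" "set qs \<subseteq> products_of_squares"
    using assms unfolding sums_of_products_of_squares_def by blast
  then show ?thesis
    unfolding sums_of_products_of_squares_def by (intro CollectI exI[of _ "ps @ qs"]) simp
qed

lemma mult_mem_products:
  assumes "x \<in> products_of_squares" "y \<in> products_of_squares"
  shows "x * y \<in> products_of_squares"
proof -
  obtain as bs where "as \<noteq> []" "x = prod_list (map (\<lambda>a. a\<^sup>2) as)" "y = prod_list (map (\<lambda>a. a\<^sup>2) bs)"
    using assms unfolding products_of_squares_def by blast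
  then show ?thesis
    unfolding products_of_squares_def by (intro CollectI exI[of _ "as @ bs"]) simp
qed

lemma mult_mem_sums:
  assumes "x \<in> sums_of_products_of_squares" "y \<in> sums_of_products_of_squares"
  shows "x * y \<in> sums_of_products_of_squares"
proof -
  obtain ps qs where ps: "x = sum_list ps" "set ps \<subseteq> products_of_squares"
    and qs: "y = sum_list qs" "set qs \<subseteq> products_of_squares"
    using assms unfolding sums_of_products_of_squares_def by blast
  let ?rs = "concat (map (\<lambda>p. map ((*) p) qs) ps)"
  have "x * y = sum_list ?rs"
    unfolding ps(1) qs(1)
    by (induction ps) (simp_all add: distrib_right sum_list_const_mult)
  moreover have "set ?rs \<subseteq> products_of_squares"
    using ps(2) qs(2) mult_mem_products by auto
  ultimately show ?thesis
    unfolding sums_of_products_of_squares_def by blast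
qed

theorem theorem28:
  assumes "\<forall>a :: 'a::division_ring. \<exists>k::nat. k \<ge> 1 \<and> a - of_nat k \<notin> sums_of_products_of_squares"
  shows "(\<forall>a b :: 'a. a * b = b * a) \<and> formally_real TYPE('a)"
proof -
  have real: "- 1 \<notin> (sums_of_products_of_squares :: 'a set)"
  proof
    assume neg: "- 1 \<in> (sums_of_products_of_squares :: 'a set)"
    have zero: "0 \<in> (sums_of_products_of_squares :: 'a set)"
      using square_mem_sums[of "0::'a"] by simp
    have "- of_nat k \<in> (sums_of_products_of_squares :: 'a set)" for k
    proof (induction k)
      case (Suc k)
      then show ?case
        using add_mem_sums[OF neg Suc] by simp
    qed (simp add: zero)
    then show False
      using assms[rule_format, of 0] by simp
  qed
  interpret weakly_archimedean_ring_preordering "sums_of_products_of_squares :: 'a set"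
    using real assms
    by unfold_locales (auto intro: square_mem_sums add_mem_sums mult_mem_sums)
  show ?thesis
    using real commute unfolding formally_real_def by blast
qed

end
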